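(* Let $l\ge1$ be an integer. Define recursively universal polynomials $Q^{l+1}_{rl+1}(y,t)\in\boldsymbol{q}[y,t]$, $r\ge1$, by $Q^{l+1}_{l+1}(y,t)=y$ and, for $r\ge2$, with $n=(r+1)l+1$, $$ \begin{aligned} Q^{l+1}_{rl+1}(y,t)=\frac{1}{(r-1)l}\Bigg(&\sum_{\overline{u}_n\in\check{U}^{l+1}_{n,l+1}}B_{\overline{u}_n}\prod_{j=1}^{r-1}Q^{l+1}_{jl+1}(y,t)^{u_{jl+1}}+t\sum_{\overline{u}_n\in U^{l+1}_{n,2l+1}}B_{\overline{u}_n}\prod_{j=1}^{r-1}Q^{l+1}_{jl+1}(y,t)^{u_{jl+1}}\\ &-t\,((r-1)l+1)\,Q^{l+1}_{(r-1)l+1}(y,t)\Bigg). \end{aligned} $$ Let $\delta\in\boldsymbol{k}$ and $\widetilde H(x)=x^{l+1}+\delta x^{2l+1}$. Then for each $\widetilde c_{l+1}\in\boldsymbol{k}$, $$\widetilde\Phi_{\widetilde c_{l+1}}(x)=x+\widetilde c_{l+1}x^{l+1}+\sum_{p=2}^\infty Q^{l+1}_{pl+1}(\widetilde c_{l+1},\delta)\,x^{pl+1}$$ is the unique element of $\mathcal{S}_1(\mathrm{AJ}_\infty(\widetilde H))$ whose coefficient at $x^{l+1}$ is $\widetilde c_{l+1}$, and $\mathcal{S}_1(\mathrm{AJ}_\infty(\widetilde H))\subset\mathcal{N}^{\infty,l}$. Moreover, $\pi^\infty_{l+1}:\mathcal{S}_1(\mathrm{AJ}_\infty(\widetilde H))\to\Gamma^{l,l}_1$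 is an isomorphism, and the group $\mathcal{S}_1(\mathrm{AJ}_\infty(\widetilde H))$ is commutative and isomorphic to $(\boldsymbol{k},+)$.
   Context: $\boldsymbol{k}$ is a field of characteristic $0$, $\boldsymbol{q}\subset\boldsymbol{k}$ its prime field (isomorphic to $\mathbb{Q}$). $\Gamma^\infty$ is the group under substitution $\circ$ of series $f\in\boldsymbol{k}[[x]]$ of order exactly $1$; for $s\in\mathbb{N}$, $\Gamma^s$ is the analogous group of $s$-truncated series in $\boldsymbol{k}[[x]]/(x^{s+1})$ (polynomials of degree $\le s$, substitution mod $x^{s+1}$). $\Gamma^\infty_1=\{f\in\Gamma^\infty:f\equiv x\bmod x^2\}$. $\pi^\infty_{s}$ is truncation $\sum_{j\ge1} c_jx^j\mapsto\sum_{j=1}^{s}c_jx^j$. $(\mathrm{AJ}_\infty(H))$ is the equation $(H\circ\Phi)(x)=\frac{d\Phi}{dx}\cdot H(x)$ in $\boldsymbol{k}[[x]]$; $\mathcal{S}(\mathrm{AJ}_\infty(H))$ is the group (under substitution) of its solutions $\Phi\in\Gamma^\infty$, and $\mathcal{S}_1(\mathrm{AJ}_\infty(H))=\mathcal{S}(\mathrm{AJ}_\infty(H))\cap\Gamma^\infty_1$. $\mathcal{N}^{\infty,l}=\{f\in\Gamma^\infty: f(x)=\sum_{j\ge0}c_{jl+1}x^{jl+1}\}$. $\Gamma^{l,l}_1=\{x+c_{l+1}x^{l+1}\in\Gamma^{l+1}:c_{l+1}\in\boldsymbol{k}\}$, a group under substitution mod $x^{l+2}$. For $1\le i\le n$: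 $U_{n,i}=\{\overline{u}_n=(u_1,\dots,u_n)\in\{0,\dots,i\}^n:\sum_{j=1}^n u_j=i,\ \sum_{j=1}^n ju_j=n\}$ and $B_{\overline{u}_n}=i!/\prod_{j=1}^n u_j!$ for $\overline u_n\in U_{n,i}$. $U^{l+1}_{n,i}$ is the set of $\overline{u}_n\in U_{n,i}$ such that $u_j=0$ for all $j\in\{2,\dots,n-i+1\}$ with $j\not\equiv1\pmod l$ and for all $j\in\{n-i+2,\dots,n\}$. $\check{U}^{l+1}_{n,l+1}$ is the set of $\overline{u}_n\in U^{l+1}_{n,l+1}$ such that moreover $u_{n-l}=0$ (so $u_j=0$ for all $j\in\{n-l,\dots,n\}$). *)

theory Defs
  imports
    "HOL-Computational_Algebra.Computational_Algebra"
    "HOL-Number_Theory.Cong"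
    "HOL-Algebra.Group"
begin

definition Gamma_inf :: "('a::field_char_0) fps monoid" where
  "Gamma_inf =
     \<lparr>carrier = {f. fps_nth f 0 = 0 \<and> fps_nth f 1 \<noteq> 0},
      mult = (\<lambda>f g. f oo g), one = fps_X\<rparr>"

definition Gamma_inf_1 :: "('a::field_char_0) fps set" where
  "Gamma_inf_1 = {f \<in> carrier Gamma_inf. fps_nth f 1 = 1}"

text \<open>Series truncated at order \<open>s\<close> are represented by polynomials of degree at most \<open>s\<close>,
  the canonical representatives modulo \<open>x^(s+1)\<close>; \<open>s \<ge> 1\<close> is intended.\<close>

definition Gamma_trunc :: "nat \<Rightarrow> ('a::field_char_0) poly monoid" where
  "Gamma_trunc s =
     \<lparr>carrier = {p. degree p \<le> s \<and> coeff p 0 = 0 \<and> coeff p 1 \<noteq> 0},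
      mult = (\<lambda>p q. pcompose p q mod monom 1 (s + 1)), one = [:0, 1:]\<rparr>"

definition truncation :: "nat \<Rightarrow> ('a::field_char_0) fps \<Rightarrow> 'a poly" where
  "truncation s f = (\<Sum>j=1..s. monom (fps_nth f j) j)"

definition Gamma_ll_1 :: "nat \<Rightarrow> ('a::field_char_0) poly monoid" where
  "Gamma_ll_1 l = Gamma_trunc (l + 1)\<lparr>carrier := {[:0, 1:] + monom c (l + 1) | c. True}\<rparr>"

definition N_inf :: "nat \<Rightarrow> ('a::field_char_0) fps set" where
  "N_inf l = {f \<in> carrier Gamma_inf. \<forall>m. fps_nth f m \<noteq> 0 \<longrightarrow> (\<exists>j. m = j * l + 1)}"

definition additive_group :: "('a::field_char_0) monoid" where
  "additive_group = \<lparr>carrier = UNIV, mult = (+), one = 0\<rparr>"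

definition AJ_sol :: "('a::field_char_0) fps \<Rightarrow> 'a fps set" where
  "AJ_sol H = {\<Phi> \<in> carrier Gamma_inf. H oo \<Phi> = fps_deriv \<Phi> * H}"

definition AJ_sol_1 :: "('a::field_char_0) fps \<Rightarrow> 'a fps set" where
  "AJ_sol_1 H = AJ_sol H \<inter> Gamma_inf_1"

definition AJ_group_1 :: "('a::field_char_0) fps \<Rightarrow> 'a fps monoid" where
  "AJ_group_1 H = Gamma_inf\<lparr>carrier := AJ_sol_1 H\<rparr>"

text \<open>A tuple \<open>(u\<^sub>1, \<dots>, u\<^sub>n)\<close> is an extensional function on \<open>{1..n}\<close>.\<close>

definition U :: "nat \<Rightarrow> nat \<Rightarrow> (nat \<Rightarrow> nat) set" where
  "U n i = {u \<in> {1..n} \<rightarrow>\<^sub>E {0..i}. (\<Sum>j=1..n. u j) = i \<and> (\<Sum>j=1..n. j * u j) = n}"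

definition B :: "nat \<Rightarrow> nat \<Rightarrow> (nat \<Rightarrow> nat) \<Rightarrow> rat" where
  "B n i u = fact i / (\<Prod>j=1..n. fact (u j))"

text \<open>\<open>Ul l n i\<close> is the set with superscript \<open>l + 1\<close>. The natural-number subtraction
  \<open>n - i\<close> is exact since only \<open>1 \<le> i \<le> n\<close> is used.\<close>

definition Ul :: "nat \<Rightarrow> nat \<Rightarrow> nat \<Rightarrow> (nat \<Rightarrow> nat) set" where
  "Ul l n i =
     {u \<in> U n i. (\<forall>j\<in>{2..n - i + 1}. \<not> [j = 1] (mod l) \<longrightarrow> u j = 0) \<and>
                 (\<forall>j\<in>{n - i + 2..n}. u j = 0)}"

definition Ul_check :: "nat \<Rightarrow> nat \<Rightarrow> (nat \<Rightarrow> nat) set" where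
  "Ul_check l n = {u \<in> Ul l n (l + 1). u (n - l) = 0}"

text \<open>The prime field is represented by \<open>rat\<close>, embedded by \<open>of_rat\<close>, and its polynomial ring
  in \<open>y, t\<close> by \<open>rat poly poly\<close>: the outer indeterminate is \<open>y\<close>, the inner one is \<open>t\<close>.\<close>

definition var_y :: "rat poly poly" where
  "var_y = [:0, 1:]"

definition var_t :: "rat poly poly" where
  "var_t = [:[:0, 1:]:]"

definition const2 :: "rat \<Rightarrow> rat poly poly" where
  "const2 a = [:[:a:]:]"

definition eval2 :: "rat poly poly \<Rightarrow> 'a::field_char_0 \<Rightarrow> 'a \<Rightarrow> 'a" where
  "eval2 P c d = poly (map_poly (\<lambda>p. poly (map_poly of_rat p) d) P) c"

text \<open>\<open>Q l r\<close> is the polynomial with superscript \<open>l + 1\<close> and subscript \<open>r * l + 1\<close>, for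
  \<open>r \<ge> 1\<close>; the value at \<open>r = 0\<close> is junk and not used.\<close>

fun Q :: "nat \<Rightarrow> nat \<Rightarrow> rat poly poly" where
  "Q l r =
     (if r = 0 then 0
      else if r = 1 then var_y
      else
        const2 (1 / of_nat ((r - 1) * l)) *
        ((\<Sum>u\<in>Ul_check l ((r + 1) * l + 1).
            const2 (B ((r + 1) * l + 1) (l + 1) u) * (\<Prod>j=1..r - 1. Q l j ^ u (j * l + 1)))
         + var_t * (\<Sum>u\<in>Ul l ((r + 1) * l + 1) (2 * l + 1).
            const2 (B ((r + 1) * l + 1) (2 * l + 1) u) * (\<Prod>j=1..r - 1. Q l j ^ u (j * l + 1)))
         - var_t * of_nat ((r - 1) * l + 1) * Q l (r - 1)))"

declare Q.simps [simp del]

definition H_tilde :: "nat \<Rightarrow> 'a::field_char_0 \<Rightarrow> 'a fps" where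
  "H_tilde l \<delta> = fps_X ^ (l + 1) + fps_const \<delta> * fps_X ^ (2 * l + 1)"

text \<open>The infinite sum is taken in the \<open>x\<close>-adic metric on \<open>'a fps\<close>, where it converges for
  \<open>l \<ge> 1\<close>; its index is shifted so that it starts at \<open>p = 2\<close>.\<close>

definition Phi_tilde :: "nat \<Rightarrow> 'a::field_char_0 \<Rightarrow> 'a \<Rightarrow> 'a fps" where
  "Phi_tilde l \<delta> c =
     fps_X + fps_const c * fps_X ^ (l + 1)
     + (\<Sum>k. fps_const (eval2 (Q l (k + 2)) c \<delta>) * fps_X ^ ((k + 2) * l + 1))"

end

theory Submission
  imports Defs
begin

text \<open>Write \<open>H = x^(l+1) + \<delta> x^(2l+1)\<close> and \<open>E(f) = H \<circ> f - f' H\<close>; a solution tangent to the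
  identity is a zero of \<open>E\<close>. Everything rests on one comparison (lemma \<open>AJ_defect_diff\<close>): if
  \<open>f\<close> and \<open>g\<close> are tangent to the identity and agree below degree \<open>m \<ge> 2\<close>, then \<open>E(f)\<close> and \<open>E(g)\<close>
  agree below degree \<open>m + l\<close>, and there they differ by \<open>(l + 1 - m) (f\<^sub>m - g\<^sub>m)\<close>. The factor
  \<open>l + 1\<close> comes from the power \<open>f^(l+1)\<close> and the factor \<open>m\<close> from \<open>f'\<close>, while \<open>\<delta> x^(2l+1)\<close> contributes
  only in higher degrees. So the equation in degree \<open>m + l\<close> determines the coefficient in degree
  \<open>m\<close> from the lower ones, for every \<open>m \<noteq> l + 1\<close>; at the resonance \<open>m = l + 1\<close> the
  coefficient drops out. Hence a solution is determined by its coefficient \<open>c\<close> at \<open>x^(l+1)\<close>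
  (\<open>AJ_sol_1_unique\<close>).

  For existence, the universal series is supported on exponents congruent to 1 modulo \<open>l\<close>, and this
  passes to \<open>E\<close>, so only such degrees matter. Up to degree \<open>2l + 1\<close>, comparison with the solution
  \<open>x\<close> suffices. In degree \<open>(r+1)l + 1\<close> with \<open>r \<ge> 2\<close>, the comparison lemma says that the
  coefficient at \<open>x^(rl+1)\<close> contributes \<open>-(r-1)l\<close> times itself to the defect, and the multinomial
  expansion of the defect of the series without this coefficient is the bracket in the recursion
  for \<open>Q\<close>. Thus the recursion is the equation in degree \<open>(r+1)l + 1\<close> (\<open>Phi_tilde_in_AJ_sol_1\<close>).

  For the group structure, solutions are closed under substitution by the chain rule, and for two
  series of this shape the coefficients at \<open>x^(l+1)\<close> add up. By uniqueness the composition of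
  the solutions with parameters \<open>c\<close> and \<open>d\<close> is the one with parameter \<open>c + d\<close>
  (\<open>Phi_tilde_compose\<close>), so \<open>c \<mapsto> \<Phi>\<^sub>c\<close> transports the group structure of the additive group of
  the field to the solutions, and its composition with truncation transports it to the truncated
  series \<open>x + c x^(l+1)\<close>.\<close>

section \<open>Multinomial expansion of the coefficients of a power\<close>

text \<open>Dividing by \<open>k!\<close> turns the multinomial theorem into a convolution identity without
  coefficients, which makes the induction on the number of summands straightforward.\<close>
definition divided_power :: "'a::field_char_0 fps \<Rightarrow> nat \<Rightarrow> 'a fps" where
  "divided_power f k = fps_const (1 / fact k) * f ^ k"

lemma divided_power_add:
  "divided_power (f + g) k = (\<Sum>i\<le>k. divided_power f i * divided_power g (k - i))"
proof -
  have "divided_power (f + g) k =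
      (\<Sum>i\<le>k. fps_const (1 / fact k) * (of_nat (k choose i) * f ^ i * g ^ (k - i)))"
    by (simp add: divided_power_def binomial_ring sum_distrib_left)
  also have "\<dots> = (\<Sum>i\<le>k. divided_power f i * divided_power g (k - i))"
  proof (rule sum.cong[OF refl])
    fix i assume "i \<in> {..k}"
    hence "(1 / fact k :: 'a) * of_nat (k choose i) = (1 / fact i) * (1 / fact (k - i))"
      by (simp add: binomial_fact)
    hence "fps_const (1 / fact k :: 'a) * of_nat (k choose i) =
        fps_const (1 / fact i) * fps_const (1 / fact (k - i))"
      by (metis fps_of_nat fps_const_mult)
    thus "fps_const (1 / fact k) * (of_nat (k choose i) * f ^ i * g ^ (k - i)) =
        divided_power f i * divided_power g (k - i)"
      unfolding divided_power_def by (metis (no_types, lifting) mult.assoc mult.left_commute)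
  qed
  finally show ?thesis .
qed

text \<open>The bound \<open>N\<close> on the exponents is independent of their sum \<open>k\<close> because the induction splits off
  one exponent and so lowers the sum while the range stays fixed.\<close>
lemma divided_power_sum:
  assumes "finite S" "k \<le> N"
  shows "divided_power (\<Sum>j\<in>S. f j) k =
    (\<Sum>u | u \<in> S \<rightarrow>\<^sub>E {0..N} \<and> sum u S = k. \<Prod>j\<in>S. divided_power (f j) (u j))"
  using assms
proof (induction S arbitrary: k rule: finite_induct)
  case empty
  show ?case by (cases "k = 0") (simp_all add: divided_power_def power_0_left)
next
  case (insert a S)
  let ?V = "\<lambda>k. {u. u \<in> S \<rightarrow>\<^sub>E {0..N} \<and> sum u S = k}"
  let ?W = "{u. u \<in> insert a S \<rightarrow>\<^sub>E {0..N} \<and> sum u (insert a S) = k}"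
  let ?P = "\<lambda>T u. \<Prod>j\<in>T. divided_power (f j) (u j)"
  have fin: "finite (?V k)" for k
    by (rule finite_subset[OF _ finite_PiE[of S "\<lambda>_. {0..N}"]]) (use insert.hyps in auto)
  have upd: "sum (u(a := i)) S = sum u S" "?P S (u(a := i)) = ?P S u" for u i
    by (rule sum.cong prod.cong; use insert.hyps in force)+
  have "divided_power (\<Sum>j\<in>insert a S. f j) k =
      (\<Sum>i\<le>k. divided_power (f a) i * divided_power (\<Sum>j\<in>S. f j) (k - i))"
    by (simp add: divided_power_add insert.hyps)
  also have "\<dots> = (\<Sum>i\<le>k. \<Sum>u\<in>?V (k - i). divided_power (f a) i * ?P S u)"
    using insert.prems by (intro sum.cong refl) (simp add: insert.IH sum_distrib_left)
  also have "\<dots> = (\<Sum>(i, u)\<in>(SIGMA i:{..k}. ?V (k - i)). divided_power (f a) i * ?P S u)"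
    using fin by (subst sum.Sigma) auto
  also have "\<dots> = (\<Sum>u\<in>?W. ?P (insert a S) u)"
  proof (rule sum.reindex_bij_witness[of _ "\<lambda>u. (u a, u(a := undefined))" "\<lambda>(i, u). u(a := i)"],
      goal_cases)
    case (1 p)
    thus ?case using insert.hyps by (auto simp: PiE_def extensional_def fun_eq_iff)
  next
    case (2 p)
    then obtain i u where p: "p = (i, u)" "i \<le> k" "u \<in> S \<rightarrow>\<^sub>E {0..N}" "sum u S = k - i"
      by blast
    have "u(a := i) \<in> insert a S \<rightarrow>\<^sub>E {0..N}"
      using p insert.prems by (intro PiE_fun_upd) auto
    moreover have "sum (u(a := i)) (insert a S) = k"
      unfolding sum.insert[OF insert.hyps] upd using p by simp
    ultimately show ?case unfolding p by simp
  next
    case (3 u)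
    show ?case by simp
  next
    case (4 u)
    have "u a + sum u S = k" using 4 sum.insert[OF insert.hyps, of u] by simp
    moreover have "u(a := undefined) \<in> S \<rightarrow>\<^sub>E {0..N}"
      using 4 insert.hyps by (intro fun_upd_in_PiE) auto
    ultimately show ?case by (simp add: upd(1) del: fun_upd_apply)
  next
    case (5 p)
    obtain i u where p: "p = (i, u)" by force
    show ?case unfolding p prod.insert[OF insert.hyps]
      by (simp add: upd(2) fun_upd_same del: fun_upd_apply)
  qed
  finally show ?case .
qed

lemma fps_power_nth_cong:
  fixes f g :: "'a::comm_ring_1 fps"
  assumes "\<And>k. k \<le> n \<Longrightarrow> fps_nth f k = fps_nth g k" "m \<le> n"
  shows "fps_nth (f ^ i) m = fps_nth (g ^ i) m"
  using assms(2)
proof (induction i arbitrary: m)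
  case (Suc i)
  show ?case unfolding power_Suc fps_mult_nth
    by (rule sum.cong) (use Suc assms(1) in auto)
qed simp

lemma prod_fps_monomials:
  fixes a :: "'i \<Rightarrow> 'a::comm_ring_1"
  shows "(\<Prod>j\<in>S. fps_const (a j) * fps_X ^ e j) = fps_const (\<Prod>j\<in>S. a j) * fps_X ^ (\<Sum>j\<in>S. e j)"
proof (induction S rule: infinite_finite_induct)
  case (insert x F)
  show ?case unfolding prod.insert[OF insert(1,2)] sum.insert[OF insert(1,2)] insert(3)
    by (simp add: power_add algebra_simps flip: fps_const_mult)
qed simp_all

lemma of_rat_fact: "of_rat (fact n) = (fact n :: 'a::field_char_0)"
  by (metis of_nat_fact of_rat_of_nat_eq)

text \<open>Only the terms of \<open>f\<close> of degrees \<open>1\<close> to \<open>n\<close> affect degree \<open>n\<close> of a power. For this finite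
  sum of monomials, the second condition in the definition of \<open>U\<close> selects the products of
  degree \<open>n\<close>.\<close>
lemma fps_power_nth_multinomial:
  fixes f :: "'a::field_char_0 fps"
  assumes "fps_nth f 0 = 0"
  shows "fps_nth (f ^ i) n =
    (\<Sum>u\<in>U n i. of_rat (B n i u) * (\<Prod>j=1..n. fps_nth f j ^ u j))"
proof -
  define p where "p = (\<Sum>j=1..n. fps_const (fps_nth f j) * fps_X ^ j)"
  let ?V = "{u. u \<in> {1..n} \<rightarrow>\<^sub>E {0..i} \<and> sum u {1..n} = i}"
  have fin: "finite ?V"
    by (rule finite_subset[OF _ finite_PiE[of "{1..n}" "\<lambda>_. {0..i}"]]) auto
  have "fps_nth p k = fps_nth f k" if "k \<le> n" for k
  proof -
    have "fps_nth p k = (\<Sum>j=1..n. if k = j then fps_nth f j else 0)"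
      unfolding p_def fps_sum_nth by (intro sum.cong) auto
    thus ?thesis using assms that by (cases "k = 0") auto
  qed
  hence "fps_nth (f ^ i) n = fps_nth (p ^ i) n"
    by (intro fps_power_nth_cong[of n]) auto
  also have "\<dots> = fact i * fps_nth (divided_power p i) n"
    by (simp add: divided_power_def)
  also have "divided_power p i =
      (\<Sum>u\<in>?V. \<Prod>j=1..n. divided_power (fps_const (fps_nth f j) * fps_X ^ j) (u j))"
    unfolding p_def by (rule divided_power_sum) auto
  also have "\<dots> = (\<Sum>u\<in>?V. \<Prod>j=1..n. fps_const (fps_nth f j ^ u j / fact (u j)) * fps_X ^ (j * u j))"
    by (intro sum.cong prod.cong refl)
       (simp add: divided_power_def power_mult_distrib fps_const_power power_mult flip: mult.assoc)
  also have "\<dots> = (\<Sum>u\<in>?V. fps_const (\<Prod>j=1..n. fps_nth f j ^ u j / fact (u j)) * fps_X ^ (\<Sum>j=1..n. j * u j))"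
    by (simp only: prod_fps_monomials)
  also have "fact i * fps_nth \<dots> n = (\<Sum>u\<in>?V. if (\<Sum>j=1..n. j * u j) = n
      then of_rat (B n i u) * (\<Prod>j=1..n. fps_nth f j ^ u j) else 0)"
    unfolding fps_sum_nth sum_distrib_left
    by (intro sum.cong refl)
       (auto simp: B_def of_rat_divide prod_dividef of_rat_prod of_rat_fact)
  also have "\<dots> = (\<Sum>u\<in>U n i. of_rat (B n i u) * (\<Prod>j=1..n. fps_nth f j ^ u j))"
    using fin by (subst sum.inter_filter [symmetric]) (auto simp: U_def intro!: sum.cong)
  finally show ?thesis .
qed

section \<open>The index sets of the recursion\<close>

text \<open>One part equals \<open>j\<close>, the other \<open>i - 1\<close> parts are at least \<open>1\<close>, and they add up to \<open>n\<close>.\<close>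
lemma U_part_bound:
  assumes "u \<in> U n i" "u j \<noteq> 0" "j \<in> {1..n}"
  shows "j + i \<le> n + 1"
proof -
  have s: "(\<Sum>k=1..n. u k) = i" "(\<Sum>k=1..n. k * u k) = n"
    using assms(1) by (auto simp: U_def)
  have "n = j * u j + (\<Sum>k\<in>{1..n} - {j}. k * u k)"
    using s(2) sum.remove[OF finite_atLeastAtMost assms(3), of "\<lambda>k. k * u k"] by linarith
  moreover have "i = u j + (\<Sum>k\<in>{1..n} - {j}. u k)"
    using s(1) sum.remove[OF finite_atLeastAtMost assms(3), of u] by linarith
  moreover have "(\<Sum>k\<in>{1..n} - {j}. u k) \<le> (\<Sum>k\<in>{1..n} - {j}. k * u k)"
    by (intro sum_mono) auto
  moreover have "j + u j \<le> j * u j + 1"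
  proof -
    obtain a where "u j = Suc a" using assms(2) by (cases "u j") auto
    moreover obtain b where "j = Suc b" using assms(3) by (cases j) auto
    ultimately show ?thesis by simp
  qed
  ultimately show ?thesis by linarith
qed

text \<open>The index sets of the two sums in the recursion are cut out by different conditions, but in degree
  \<open>n = (r+1)l + 1\<close> both describe partitions into parts \<open>kl + 1\<close> with \<open>k < r\<close>, that is, the monomials
  that involve only the coefficients known before step \<open>r\<close>.\<close>
definition U_sparse :: "nat \<Rightarrow> nat \<Rightarrow> nat \<Rightarrow> nat \<Rightarrow> (nat \<Rightarrow> nat) set" where
  "U_sparse l r n i = {u \<in> U n i. \<forall>j\<in>{1..n}. u j \<noteq> 0 \<longrightarrow> (\<exists>k<r. j = k * l + 1)}"

lemma cong_1_iff:
  fixes j l :: nat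
  shows "1 \<le> j \<Longrightarrow> [j = 1] (mod l) \<longleftrightarrow> (\<exists>k. j = k * l + 1)"
  unfolding cong_to_1'_nat by (auto simp del: One_nat_def)

lemma Ul_eq_U_sparse:
  assumes "1 \<le> l" "2 \<le> r"
  shows "Ul l ((r + 1) * l + 1) (2 * l + 1) = U_sparse l r ((r + 1) * l + 1) (2 * l + 1)"
proof -
  define n where "n = (r + 1) * l + 1"
  obtain s where r: "r = Suc (Suc s)" using assms by (metis Suc_le_D numeral_2_eq_2 Suc_le_mono)
  have n: "n - (2 * l + 1) = (r - 1) * l" by (simp add: n_def r)
  have nl: "(r - 1) * l + 1 \<le> n" by (simp add: n_def r)
  have eq: "(\<forall>j\<in>{2..n - (2*l+1) + 1}. \<not> [j = 1] (mod l) \<longrightarrow> u j = 0) \<and> (\<forall>j\<in>{n - (2*l+1) + 2..n}. u j = 0)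
     \<longleftrightarrow> (\<forall>j\<in>{1..n}. u j \<noteq> 0 \<longrightarrow> (\<exists>k<r. j = k * l + 1))" (is "?L \<longleftrightarrow> ?R") for u
  proof
    assume L: ?L
    show ?R
    proof (intro ballI impI)
      fix j assume j: "j \<in> {1..n}" "u j \<noteq> 0"
      have le: "j \<le> (r - 1) * l + 1" using L j unfolding n by force
      have "[j = 1] (mod l)" using L j le unfolding n by (cases "j = 1") (auto simp: cong_def)
      then obtain k where k: "j = k * l + 1" using j cong_1_iff[of j l] by auto
      moreover have "k \<le> r - 1" using le assms k by simp
      ultimately show "\<exists>k<r. j = k * l + 1" using assms by (intro exI[of _ k]) auto
    qed
  next
    assume R: ?R
    have le: "k * l \<le> (r - 1) * l" if "k < r" for k using that by (intro mult_right_mono) auto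
    show ?L
    proof (intro conjI ballI impI; rule ccontr)
      fix j assume j: "j \<in> {2..n - (2*l+1) + 1}" "\<not> [j = 1] (mod l)" "u j \<noteq> 0"
      hence "j \<in> {1..n}" using nl unfolding n by auto
      thus False using R j cong_1_iff[of j l] by auto
    next
      fix j assume j: "j \<in> {n - (2*l+1) + 2..n}" "u j \<noteq> 0"
      hence "j \<in> {1..n}" by auto
      then obtain k where "k < r" "j = k * l + 1" using R j by blast
      moreover have "(r - 1) * l + 2 \<le> j" using j unfolding n by simp
      ultimately show False using le[of k] by linarith
    qed
  qed
  show ?thesis unfolding n_def[symmetric] Ul_def U_sparse_def by (simp only: eq)
qed

text \<open>Here \<open>n - l = rl + 1\<close>, so the additional condition \<open>u (n - l) = 0\<close> removes exactly the monomial that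
  contains the coefficient to be determined in step \<open>r\<close>.\<close>
lemma Ul_check_eq_U_sparse:
  assumes "1 \<le> l"
  shows "Ul_check l ((r + 1) * l + 1) = U_sparse l r ((r + 1) * l + 1) (l + 1)"
proof -
  define n where "n = (r + 1) * l + 1"
  have n: "n - (l + 1) = r * l" "n - l = r * l + 1" by (simp_all add: n_def)
  have nl: "r * l + 1 \<le> n" by (simp add: n_def)
  have eq: "(\<forall>j\<in>{2..n - (l+1) + 1}. \<not> [j = 1] (mod l) \<longrightarrow> u j = 0) \<and> (\<forall>j\<in>{n - (l+1) + 2..n}. u j = 0)
      \<and> u (n - l) = 0
     \<longleftrightarrow> (\<forall>j\<in>{1..n}. u j \<noteq> 0 \<longrightarrow> (\<exists>k<r. j = k * l + 1))" (is "?L \<longleftrightarrow> ?R") for u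
  proof
    assume L: ?L
    show ?R
    proof (intro ballI impI)
      fix j assume j: "j \<in> {1..n}" "u j \<noteq> 0"
      have le: "j \<le> r * l + 1" using L j unfolding n by force
      have ne: "j \<noteq> r * l + 1" using L j unfolding n by force
      have "[j = 1] (mod l)" using L j le unfolding n by (cases "j = 1") (auto simp: cong_def)
      then obtain k where k: "j = k * l + 1" using j cong_1_iff[of j l] by auto
      moreover have "k < r" using le ne assms k by (auto simp: less_le)
      ultimately show "\<exists>k<r. j = k * l + 1" by blast
    qed
  next
    assume R: ?R
    have lt: "k * l < r * l" if "k < r" for k using that assms by simp
    show ?L
    proof (intro conjI ballI impI; rule ccontr)
      fix j assume j: "j \<in> {2..n - (l+1) + 1}" "\<not> [j = 1] (mod l)" "u j \<noteq> 0"
      hence "j \<in> {1..n}" using nl unfolding n by auto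
      thus False using R j cong_1_iff[of j l] by auto
    next
      fix j assume j: "j \<in> {n - (l+1) + 2..n}" "u j \<noteq> 0"
      hence "j \<in> {1..n}" by auto
      then obtain k where "k < r" "j = k * l + 1" using R j by blast
      moreover have "r * l + 2 \<le> j" using j unfolding n by simp
      ultimately show False using lt[of k] by linarith
    next
      assume "u (n - l) \<noteq> 0"
      moreover have "n - l \<in> {1..n}" using nl unfolding n by auto
      ultimately obtain k where "k < r" "n - l = k * l + 1" using R by blast
      thus False using lt[of k] unfolding n by auto
    qed
  qed
  show ?thesis unfolding n_def[symmetric] Ul_check_def Ul_def U_sparse_def
    by (simp only: eq mem_Collect_eq conj_assoc)
qed

text \<open>The hypothesis on vanishing coefficients is limited to \<open>j + i \<le> n + 1\<close> because no larger
  part occurs by \<open>U_part_bound\<close>; coefficients of \<open>f\<close> beyond that degree are arbitrary. The part \<open>1\<close> is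
  missing from the products on the right since its coefficient is \<open>1\<close>.\<close>
lemma fps_power_nth_sparse:
  fixes f :: "'a::field_char_0 fps"
  assumes "1 \<le> l" "fps_nth f 0 = 0" "fps_nth f 1 = 1" "r * l \<le> n"
    and zero: "\<And>j. j + i \<le> n + 1 \<Longrightarrow> \<nexists>k. k < r \<and> j = k * l + 1 \<Longrightarrow> fps_nth f j = 0"
  shows "fps_nth (f ^ i) n =
    (\<Sum>u\<in>U_sparse l r n i. of_rat (B n i u) * (\<Prod>k=1..r - 1. fps_nth f (k * l + 1) ^ u (k * l + 1)))"
proof -
  have fin: "finite (U n i)"
    unfolding U_def by (rule finite_subset[OF _ finite_PiE[of "{1..n}" "\<lambda>_. {0..i}"]]) auto
  have "fps_nth (f ^ i) n = (\<Sum>u\<in>U n i. of_rat (B n i u) * (\<Prod>j=1..n. fps_nth f j ^ u j))"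
    by (rule fps_power_nth_multinomial) fact
  also have "\<dots> = (\<Sum>u\<in>U_sparse l r n i. of_rat (B n i u) * (\<Prod>j=1..n. fps_nth f j ^ u j))"
  proof (rule sum.mono_neutral_right[OF fin])
    show "\<forall>u\<in>U n i - U_sparse l r n i. of_rat (B n i u) * (\<Prod>j=1..n. fps_nth f j ^ u j) = 0"
    proof
      fix u assume u: "u \<in> U n i - U_sparse l r n i"
      then obtain j where j: "j \<in> {1..n}" "u j \<noteq> 0" "\<nexists>k. k < r \<and> j = k * l + 1"
        by (auto simp: U_sparse_def)
      hence "fps_nth f j = 0" using u by (intro zero U_part_bound) auto
      hence "(\<Prod>j=1..n. fps_nth f j ^ u j) = 0"
        using j by (intro prod_zero bexI[of _ j]) auto
      thus "of_rat (B n i u) * (\<Prod>j=1..n. fps_nth f j ^ u j) = 0" by simp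
    qed
  qed (auto simp: U_sparse_def)
  also have "\<dots> = (\<Sum>u\<in>U_sparse l r n i. of_rat (B n i u) * (\<Prod>k=1..r - 1. fps_nth f (k * l + 1) ^ u (k * l + 1)))"
  proof (rule sum.cong[OF refl])
    fix u assume u: "u \<in> U_sparse l r n i"
    have inj: "inj_on (\<lambda>k. k * l + 1) {1..r - 1}" using assms(1) by (auto simp: inj_on_def)
    have "k * l + 1 \<le> n" if "k \<in> {1..r-1}" for k
    proof -
      have "Suc k * l \<le> r * l" using that by (intro mult_right_mono) auto
      thus ?thesis using assms(1,4) by simp
    qed
    hence sub: "(\<lambda>k. k * l + 1) ` {1..r - 1} \<subseteq> {1..n}"
      unfolding image_subset_iff by simp
    have "(\<Prod>j=1..n. fps_nth f j ^ u j) = (\<Prod>j\<in>(\<lambda>k. k * l + 1) ` {1..r - 1}. fps_nth f j ^ u j)"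
    proof (rule prod.mono_neutral_right[OF _ sub], simp, rule ballI)
      fix j assume j: "j \<in> {1..n} - (\<lambda>k. k * l + 1) ` {1..r - 1}"
      show "fps_nth f j ^ u j = 1"
      proof (cases "u j = 0 \<or> j = 1")
        case False
        then obtain k where "k < r" "j = k * l + 1" using u j unfolding U_sparse_def by blast
        moreover from this False have "k \<in> {1..r-1}" by (cases k) auto
        ultimately have "j \<in> (\<lambda>k. k * l + 1) ` {1..r - 1}" by blast
        thus ?thesis using j by blast
      next
        case True
        thus ?thesis using assms(3) by auto
      qed
    qed
    also have "\<dots> = (\<Prod>k=1..r - 1. fps_nth f (k * l + 1) ^ u (k * l + 1))"
      unfolding prod.reindex[OF inj] by simp
    finally show "of_rat (B n i u) * (\<Prod>j=1..n. fps_nth f j ^ u j) =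
      of_rat (B n i u) * (\<Prod>k=1..r - 1. fps_nth f (k * l + 1) ^ u (k * l + 1))" by simp
  qed
  finally show ?thesis .
qed

section \<open>Evaluation of the universal polynomials\<close>

lemma map_poly_add_hom:
  assumes "f 0 = 0" "\<And>a b. f (a + b) = f a + f b"
  shows "map_poly f (p + q) = map_poly f p + map_poly f q"
  by (rule poly_eqI) (simp add: coeff_map_poly assms)

lemma map_poly_mult_hom:
  fixes f :: "'a::comm_semiring_0 \<Rightarrow> 'b::comm_semiring_0"
  assumes "f 0 = 0" "\<And>a b. f (a + b) = f a + f b" "\<And>a b. f (a * b) = f a * f b"
  shows "map_poly f (p * q) = map_poly f p * map_poly f q"
proof (induction p)
  case (pCons a p)
  have "map_poly f (smult a q) = smult (f a) (map_poly f q)"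
    by (rule poly_eqI) (simp add: coeff_map_poly assms)
  thus ?case using pCons
    by (simp add: map_poly_add_hom map_poly_pCons assms)
qed simp

text \<open>Evaluation at \<open>(c, d)\<close> is a composition of two coefficientwise ring homomorphisms followed by
  evaluations, so it carries the recursion for the polynomials to their values.\<close>
lemma eval2_hom:
  fixes c d :: "'a::field_char_0"
  shows eval2_0: "eval2 0 c d = 0" and eval2_1: "eval2 1 c d = 1"
    and eval2_add: "eval2 (P + R) c d = eval2 P c d + eval2 R c d"
    and eval2_mult: "eval2 (P * R) c d = eval2 P c d * eval2 R c d"
proof -
  let ?h = "\<lambda>p. poly (map_poly of_rat p) d"
  have h: "?h 0 = 0" "?h 1 = 1" "\<And>p q. ?h (p + q) = ?h p + ?h q" "\<And>p q. ?h (p * q) = ?h p * ?h q"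
    by (simp_all add: map_poly_add_hom map_poly_mult_hom of_rat_add of_rat_mult)
  show "eval2 0 c d = 0" "eval2 1 c d = 1" by (simp_all add: eval2_def)
  show "eval2 (P + R) c d = eval2 P c d + eval2 R c d"
    by (simp add: eval2_def map_poly_add_hom[where f = ?h, OF h(1,3)])
  show "eval2 (P * R) c d = eval2 P c d * eval2 R c d"
    by (simp add: eval2_def map_poly_mult_hom[where f = ?h, OF h(1,3,4)])
qed

lemma eval2_uminus: "eval2 (- P) c d = - eval2 P c d"
  using eval2_add[of P "- P" c d] by (simp add: eval2_0 eq_neg_iff_add_eq_0 add.commute)

lemma eval2_diff: "eval2 (P - R) c d = eval2 P c d - eval2 R c d"
  using eval2_add[of P "- R" c d] by (simp add: eval2_uminus)

lemma eval2_sum: "eval2 (sum F S) c d = (\<Sum>x\<in>S. eval2 (F x) c d)"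
  by (induction S rule: infinite_finite_induct) (simp_all add: eval2_hom)

lemma eval2_power: "eval2 (P ^ n) c d = eval2 P c d ^ n"
  by (induction n) (simp_all add: eval2_hom)

lemma eval2_prod: "eval2 (prod F S) c d = (\<Prod>x\<in>S. eval2 (F x) c d)"
  by (induction S rule: infinite_finite_induct) (simp_all add: eval2_hom)

lemma eval2_of_nat: "eval2 (of_nat n) c d = of_nat n"
  by (induction n) (simp_all add: eval2_hom)

lemma eval2_var_y: "eval2 var_y c d = c"
  by (simp add: eval2_def var_y_def map_poly_pCons)

lemma eval2_var_t: "eval2 var_t c d = d"
  by (simp add: eval2_def var_t_def map_poly_pCons)

lemma eval2_const2: "eval2 (const2 a) c d = of_rat a"
  by (simp add: eval2_def const2_def map_poly_pCons)

lemmas eval2_simps = eval2_hom eval2_diff eval2_sum eval2_power eval2_prod eval2_of_nat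
  eval2_var_y eval2_var_t eval2_const2

section \<open>The defect of a series in the Aczel--Jabotinsky equation\<close>

text \<open>The right-hand side writes \<open>H \<circ> f\<close> as an explicit sum of powers; this agrees with substitution for
  series without constant term.\<close>
definition AJ_defect :: "nat \<Rightarrow> 'a::field_char_0 \<Rightarrow> 'a fps \<Rightarrow> 'a fps" where
  "AJ_defect l \<delta> f = f ^ (l + 1) + fps_const \<delta> * f ^ (2 * l + 1) - fps_deriv f * H_tilde l \<delta>"

lemma AJ_sol_1_iff:
  "f \<in> AJ_sol_1 (H_tilde l \<delta>) \<longleftrightarrow>
     fps_nth f 0 = 0 \<and> fps_nth f 1 = 1 \<and> AJ_defect l \<delta> f = 0"
proof -
  have "H_tilde l \<delta> oo f = f ^ (l + 1) + fps_const \<delta> * f ^ (2 * l + 1)" if "fps_nth f 0 = 0"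
    unfolding H_tilde_def using that
    by (simp only: fps_compose_add_distrib fps_compose_mult_distrib fps_const_compose
        fps_X_fps_compose_startby0 flip: fps_compose_power)
  thus ?thesis by (auto simp: AJ_sol_1_def AJ_sol_def Gamma_inf_1_def Gamma_inf_def AJ_defect_def)
qed

lemma fps_diff_eq_X_power_mult:
  fixes f g :: "'a::comm_ring_1 fps"
  assumes "\<And>j. j < m \<Longrightarrow> fps_nth f j = fps_nth g j"
  shows "f - g = fps_X ^ m * fps_shift m (f - g)"
  by (rule fps_ext) (use assms in \<open>auto simp: fps_X_power_mult_nth\<close>)

text \<open>In \<open>f^(i+1) - g^(i+1) = (f - g) \<Sum> f^p g^(i-p)\<close> each of the \<open>i + 1\<close> summands is \<open>x^i\<close> times a series
  with constant term \<open>1\<close>.\<close>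
lemma power_Suc_diff_fps_X_power:
  fixes f g :: "'a::field_char_0 fps"
  assumes "2 \<le> m" "fps_nth f 0 = 0" "fps_nth f 1 = 1"
    and "\<And>j. j < m \<Longrightarrow> fps_nth f j = fps_nth g j"
  obtains K where "f ^ Suc i - g ^ Suc i = fps_X ^ (m + i) * K"
    and "fps_nth K 0 = of_nat (Suc i) * (fps_nth f m - fps_nth g m)"
proof -
  define F where "F = fps_shift 1 f"
  define G where "G = fps_shift 1 g"
  define D where "D = fps_shift m (f - g)"
  have g: "fps_nth g 0 = 0" "fps_nth g 1 = 1" using assms(4)[of 0] assms(4)[of 1] assms(1-3) by auto
  have f: "f = fps_X * F" and g': "g = fps_X * G"
    using assms(2) g(1) by (auto simp: F_def G_def fps_eq_iff)
  have D: "f - g = fps_X ^ m * D"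
    using fps_diff_eq_X_power_mult[of m f g] assms(4) by (simp add: D_def)
  have "f ^ Suc i - g ^ Suc i = (f - g) * (\<Sum>p<Suc i. f ^ p * g ^ (i - p))"
    using diff_power_eq_sum[of f i g] by simp
  also have "(\<Sum>p<Suc i. f ^ p * g ^ (i - p)) = fps_X ^ i * (\<Sum>p<Suc i. F ^ p * G ^ (i - p))"
    unfolding sum_distrib_left
  proof (rule sum.cong[OF refl])
    fix p assume "p \<in> {..<Suc i}"
    hence "fps_X ^ i = fps_X ^ p * (fps_X ^ (i - p) :: 'a fps)" by (simp flip: power_add)
    thus "f ^ p * g ^ (i - p) = fps_X ^ i * (F ^ p * G ^ (i - p))"
      unfolding f g' by (simp only: power_mult_distrib ac_simps)
  qed
  finally have "f ^ Suc i - g ^ Suc i = fps_X ^ (m + i) * (D * (\<Sum>p<Suc i. F ^ p * G ^ (i - p)))"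
    unfolding D by (simp only: power_add ac_simps)
  moreover have "fps_nth (D * (\<Sum>p<Suc i. F ^ p * G ^ (i - p))) 0 =
      of_nat (Suc i) * (fps_nth f m - fps_nth g m)"
    using assms(3) g(2)
    by (simp add: F_def G_def D_def fps_sum_nth fps_nth_power_0 del: sum.lessThan_Suc)
  ultimately show thesis by (rule that)
qed

text \<open>The linearisation of the equation at a series tangent to the identity: in lowest
  order it multiplies a perturbation of degree \<open>m\<close> by \<open>l + 1 - m\<close> and raises its degree by \<open>l\<close>.\<close>
lemma AJ_defect_diff:
  fixes f g :: "'a::field_char_0 fps"
  assumes "1 \<le> l" "2 \<le> m" "fps_nth f 0 = 0" "fps_nth f 1 = 1"
    and eq: "\<And>j. j < m \<Longrightarrow> fps_nth f j = fps_nth g j"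
  obtains K where "AJ_defect l \<delta> f - AJ_defect l \<delta> g = fps_X ^ (m + l) * K"
    and "fps_nth K 0 = (of_nat (l + 1) - of_nat m) * (fps_nth f m - fps_nth g m)"
proof -
  obtain K1 where K1: "f ^ Suc l - g ^ Suc l = fps_X ^ (m + l) * K1"
      "fps_nth K1 0 = of_nat (Suc l) * (fps_nth f m - fps_nth g m)"
    using power_Suc_diff_fps_X_power[OF assms(2-4) eq] .
  obtain K2 where K2: "f ^ Suc (2 * l) - g ^ Suc (2 * l) = fps_X ^ (m + 2 * l) * K2"
    using power_Suc_diff_fps_X_power[OF assms(2-4) eq] .
  define D where "D = fps_shift m (f - g)"
  obtain m' where m: "m = Suc m'" using assms(2) by (cases m) auto
  have deriv_X: "fps_deriv (fps_X ^ m :: 'a fps) = of_nat m * fps_X ^ m'"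
    by (simp only: m fps_deriv_power fps_of_nat fps_deriv_fps_X mult_1_right diff_Suc_1)
  have "fps_deriv f - fps_deriv g = fps_deriv (fps_X ^ m * D)"
    using fps_diff_eq_X_power_mult[of m f g] eq by (simp add: D_def flip: fps_deriv_sub)
  also have "\<dots> = fps_X ^ m' * (of_nat m * D + fps_X * fps_deriv D)"
    unfolding fps_deriv_mult deriv_X by (simp only: m power_Suc distrib_left ac_simps)
  finally have deriv: "fps_deriv f - fps_deriv g = fps_X ^ m' * (of_nat m * D + fps_X * fps_deriv D)" .
  have "AJ_defect l \<delta> f - AJ_defect l \<delta> g = (f ^ Suc l - g ^ Suc l) +
      fps_const \<delta> * (f ^ Suc (2 * l) - g ^ Suc (2 * l)) - (fps_deriv f - fps_deriv g) * H_tilde l \<delta>"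
    unfolding AJ_defect_def by (simp add: algebra_simps)
  also have "\<dots> = fps_X ^ (m + l) * (K1 + fps_const \<delta> * fps_X ^ l * K2 -
      (of_nat m * D + fps_X * fps_deriv D) * (1 + fps_const \<delta> * fps_X ^ l))"
    unfolding K1 K2 deriv H_tilde_def unfolding mult_2 by (simp add: m power_add algebra_simps)
  finally show thesis
    by (rule that) (use assms(1) in \<open>simp add: K1(2) D_def algebra_simps\<close>)
qed

text \<open>The factor \<open>l + 1 - n\<close> of the linearisation is nonzero for \<open>n \<noteq> l + 1\<close> in characteristic \<open>0\<close>, so
  the first degree in which two solutions differ can only be \<open>l + 1\<close>.\<close>
lemma AJ_sol_1_unique:
  assumes "1 \<le> l" "f \<in> AJ_sol_1 (H_tilde l \<delta>)" "g \<in> AJ_sol_1 (H_tilde l \<delta>)"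
    and "fps_nth f (l + 1) = fps_nth g (l + 1)"
  shows "f = g"
proof (rule fps_ext)
  fix n
  show "fps_nth f n = fps_nth g n"
  proof (induction n rule: less_induct)
    case (less n)
    show ?case
    proof (cases "n < 2 \<or> n = l + 1")
      case True
      hence "n = 0 \<or> n = 1 \<or> n = l + 1" by auto
      thus ?thesis using assms by (auto simp: AJ_sol_1_iff)
    next
      case False
      hence "2 \<le> n" by simp
      then obtain K where K: "AJ_defect l \<delta> f - AJ_defect l \<delta> g = fps_X ^ (n + l) * K"
        "fps_nth K 0 = (of_nat (l + 1) - of_nat n) * (fps_nth f n - fps_nth g n)"
        using AJ_defect_diff[OF assms(1), of n f g \<delta>] assms(2) less by (auto simp: AJ_sol_1_iff)
      have "K = 0" using K(1) assms(2,3) by (simp add: AJ_sol_1_iff)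
      hence "(of_nat (l + 1) - of_nat n :: 'a) * (fps_nth f n - fps_nth g n) = 0" using K(2) by simp
      moreover have "(of_nat (l + 1) :: 'a) \<noteq> of_nat n" using False unfolding of_nat_eq_iff by simp
      ultimately show ?thesis by simp
    qed
  qed
qed

section \<open>Series supported on a residue class\<close>

definition supported_mod :: "nat \<Rightarrow> nat \<Rightarrow> 'a::zero fps \<Rightarrow> bool" where
  "supported_mod l a f \<longleftrightarrow> (\<forall>n. fps_nth f n \<noteq> 0 \<longrightarrow> [n = a] (mod l))"

lemma supported_mod_mult:
  fixes f g :: "'a::comm_ring_1 fps"
  assumes "supported_mod l a f" "supported_mod l b g"
  shows "supported_mod l (a + b) (f * g)"
  unfolding supported_mod_def
proof (intro allI impI)
  fix n assume "fps_nth (f * g) n \<noteq> 0"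
  then obtain i where i: "i \<le> n" "fps_nth f i * fps_nth g (n - i) \<noteq> 0"
    unfolding fps_mult_nth by (auto elim!: sum.not_neutral_contains_not_neutral)
  hence "fps_nth f i \<noteq> 0" "fps_nth g (n - i) \<noteq> 0" by auto
  hence "[i + (n - i) = a + b] (mod l)"
    using assms unfolding supported_mod_def by (intro cong_add) auto
  thus "[n = a + b] (mod l)" using i by simp
qed

lemma supported_mod_power:
  fixes f :: "'a::comm_ring_1 fps"
  assumes "supported_mod l a f"
  shows "supported_mod l (i * a) (f ^ i)"
proof (induction i)
  case (Suc i)
  thus ?case using supported_mod_mult[OF assms Suc] by simp
qed (auto simp: supported_mod_def)

text \<open>All exponents of \<open>H\<close> are congruent to \<open>1\<close>, and so are those of the powers \<open>l + 1\<close> and \<open>2l + 1\<close> of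
  \<open>f\<close>; differentiation moves \<open>f\<close> to the class of \<open>0\<close> and multiplication by \<open>H\<close> moves it back.\<close>
lemma supported_mod_AJ_defect:
  fixes f :: "'a::field_char_0 fps"
  assumes "supported_mod l 1 f"
  shows "supported_mod l 1 (AJ_defect l \<delta> f)"
proof -
  have cong: "[l + 1 = 1] (mod l)" "[2 * l + 1 = 1] (mod l)"
    unfolding cong_to_1'_nat by auto
  have shift: "supported_mod l 1 g" if "supported_mod l a g" "[a = 1] (mod l)"
    for a and g :: "'a fps"
    using that unfolding supported_mod_def by (meson cong_trans)
  have "supported_mod l 0 (fps_deriv f)"
    unfolding supported_mod_def
  proof (intro allI impI)
    fix n assume "fps_nth (fps_deriv f) n \<noteq> 0"
    hence "[n + 1 = 0 + 1] (mod l)" using assms unfolding supported_mod_def by auto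
    thus "[n = 0] (mod l)" unfolding cong_add_rcancel_nat .
  qed
  moreover have "supported_mod l 1 (H_tilde l \<delta>)"
    unfolding supported_mod_def
  proof (intro allI impI)
    fix n assume "fps_nth (H_tilde l \<delta>) n \<noteq> 0"
    hence "n = l + 1 \<or> n = 2 * l + 1"
      by (cases n) (auto simp: H_tilde_def split: if_splits)
    thus "[n = 1] (mod l)" using cong by blast
  qed
  ultimately have "supported_mod l 1 (fps_deriv f * H_tilde l \<delta>)"
    using supported_mod_mult by fastforce
  moreover have "supported_mod l 1 (f ^ i)" if "[i = 1] (mod l)" for i
    using shift[OF supported_mod_power[OF assms, of i]] that by simp
  hence "supported_mod l 1 (f ^ (l + 1))" "supported_mod l 1 (f ^ (2 * l + 1))"
    using cong by blast+
  moreover have "fps_nth (f ^ (l + 1)) n \<noteq> 0 \<or> fps_nth (f ^ (2 * l + 1)) n \<noteq> 0 \<or>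
      fps_nth (fps_deriv f * H_tilde l \<delta>) n \<noteq> 0" if "fps_nth (AJ_defect l \<delta> f) n \<noteq> 0" for n
    using that by (auto simp: AJ_defect_def)
  ultimately show ?thesis
    unfolding supported_mod_def by blast
qed

section \<open>The universal solution\<close>

lemma fps_monomials_sums:
  fixes a :: "nat \<Rightarrow> 'a::comm_ring_1"
  assumes "strict_mono e" "\<And>k. fps_nth S (e k) = a k" "\<And>n. n \<notin> range e \<Longrightarrow> fps_nth S n = 0"
  shows "(\<lambda>k. fps_const (a k) * fps_X ^ e k) sums S"
  unfolding sums_def tendsto_fps_iff
proof
  fix n
  have "fps_nth (\<Sum>k<N. fps_const (a k) * fps_X ^ e k) n = fps_nth S n" if N: "n < N" for N
  proof -
    have nth: "fps_nth (\<Sum>k<N. fps_const (a k) * fps_X ^ e k) n = (\<Sum>k<N. if n = e k then a k else 0)"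
      unfolding fps_sum_nth by (intro sum.cong) auto
    show ?thesis
    proof (cases "n \<in> range e")
      case True
      then obtain k where k: "n = e k" by auto
      have "k < N" using N strict_mono_imp_increasing[OF assms(1), of k] k by simp
      moreover have "n = e i \<longleftrightarrow> k = i" for i
        using strict_mono_eq[OF assms(1)] k by auto
      ultimately show ?thesis unfolding nth by (simp add: k assms(2))
    next
      case False
      hence "(\<Sum>k<N. if n = e k then a k else 0) = 0" by (intro sum.neutral) auto
      thus ?thesis using False nth assms(3) by simp
    qed
  qed
  thus "eventually (\<lambda>N. fps_nth (\<Sum>k<N. fps_const (a k) * fps_X ^ e k) n = fps_nth S n) sequentially"
    by (auto simp: eventually_at_top_dense)
qed

text \<open>The value \<open>1\<close> at \<open>j = 0\<close> is the coefficient of \<open>x\<close>, which lets all coefficients of the universal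
  solution be treated uniformly.\<close>
definition Phi_coeff :: "nat \<Rightarrow> 'a::field_char_0 \<Rightarrow> 'a \<Rightarrow> nat \<Rightarrow> 'a" where
  "Phi_coeff l \<delta> c j = (if j = 0 then 1 else eval2 (Q l j) c \<delta>)"

lemma Phi_coeff_0: "Phi_coeff l \<delta> c 0 = 1"
  by (simp add: Phi_coeff_def)

lemma Phi_coeff_1: "Phi_coeff l \<delta> c (Suc 0) = c"
  by (simp add: Phi_coeff_def Q.simps[of l "Suc 0"] eval2_var_y)

lemma Phi_tilde_nth:
  fixes c \<delta> :: "'a::field_char_0"
  assumes "1 \<le> l"
  shows "fps_nth (Phi_tilde l \<delta> c) (j * l + 1) = Phi_coeff l \<delta> c j"
    and "\<nexists>j. n = j * l + 1 \<Longrightarrow> fps_nth (Phi_tilde l \<delta> c) n = 0"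
proof -
  define S :: "'a fps" where
    "S = Abs_fps (\<lambda>n. if \<exists>k. n = (k + 2) * l + 1 then eval2 (Q l ((n - 1) div l)) c \<delta> else 0)"
  have "(\<lambda>k. fps_const (eval2 (Q l (k + 2)) c \<delta>) * fps_X ^ ((k + 2) * l + 1)) sums S"
  proof (rule fps_monomials_sums)
    show "strict_mono (\<lambda>k. (k + 2) * l + 1)"
      using assms by (auto intro!: strict_monoI)
    show "fps_nth S ((k + 2) * l + 1) = eval2 (Q l (k + 2)) c \<delta>" for k
    proof -
      have "((k + 2) * l + 1 - 1) div l = k + 2" using assms by simp
      thus ?thesis unfolding S_def fps_nth_Abs_fps by (metis (mono_tags, lifting))
    qed
  qed (auto simp: S_def)
  hence Phi: "Phi_tilde l \<delta> c = fps_X + fps_const c * fps_X ^ (l + 1) + S"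
    unfolding Phi_tilde_def using sums_unique by blast
  have S: "fps_nth S (j * l + 1) = (if 2 \<le> j then eval2 (Q l j) c \<delta> else 0)" for j
  proof -
    have "(\<exists>k. j * l + 1 = (k + 2) * l + 1) \<longleftrightarrow> 2 \<le> j"
      using assms le_iff_add[of 2 j]
      by (simp only: add_right_cancel mult_cancel2) (auto simp: add.commute)
    moreover have "(j * l + 1 - 1) div l = j" using assms by simp
    ultimately show ?thesis by (simp only: S_def fps_nth_Abs_fps)
  qed
  show "fps_nth (Phi_tilde l \<delta> c) (j * l + 1) = Phi_coeff l \<delta> c j"
  proof -
    consider "j = 0" | "j = 1" | "2 \<le> j" by linarith
    thus ?thesis
    proof cases
      case 1
      thus ?thesis using assms S[of 0] by (simp add: Phi Phi_coeff_0)
    next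
      case 2
      thus ?thesis using assms S[of 1] by (simp add: Phi Phi_coeff_1)
    next
      case 3
      have "l < j * l" using 3 assms mult_le_mono1[of 2 j l] by linarith
      thus ?thesis using 3 S[of j] by (simp add: Phi Phi_coeff_def)
    qed
  qed
  show "fps_nth (Phi_tilde l \<delta> c) n = 0" if n: "\<nexists>j. n = j * l + 1"
  proof -
    have "n \<noteq> 1" "n \<noteq> l + 1" using n[unfolded not_ex, rule_format, of 0] n[unfolded not_ex, rule_format, of 1] by auto
    moreover have "\<nexists>k. n = (k + 2) * l + 1" using n by blast
    hence "fps_nth S n = 0" by (simp only: S_def fps_nth_Abs_fps if_False)
    ultimately show ?thesis by (cases n) (auto simp: Phi)
  qed
qed

text \<open>The defining recursion evaluated at \<open>(c, \<delta>)\<close>, with the denominator cleared and both index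
  sets in their common form.\<close>
lemma Phi_coeff_recursion:
  fixes c \<delta> :: "'a::field_char_0"
  assumes "1 \<le> l" "2 \<le> r"
  defines "n \<equiv> (r + 1) * l + 1" and "q \<equiv> Phi_coeff l \<delta> c"
  defines "P \<equiv> \<lambda>i. \<Sum>u\<in>U_sparse l r n i. of_rat (B n i u) * (\<Prod>k=1..r - 1. q k ^ u (k * l + 1))"
  shows "of_nat ((r - 1) * l) * q r = P (l + 1) + \<delta> * P (2 * l + 1) - \<delta> * of_nat ((r - 1) * l + 1) * q (r - 1)"
proof -
  have q: "eval2 (Q l k) c \<delta> = q k" if "1 \<le> k" for k
    using that by (simp add: q_def Phi_coeff_def)
  have prod: "(\<Prod>k=1..r - 1. eval2 (Q l k) c \<delta> ^ u (k * l + 1)) = (\<Prod>k=1..r - 1. q k ^ u (k * l + 1))"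
    for u :: "nat \<Rightarrow> nat"
    by (intro prod.cong) (auto simp: q)
  have r: "r \<noteq> 0" "r \<noteq> 1" "eval2 (Q l (r - 1)) c \<delta> = q (r - 1)"
    using assms(2) by (simp_all add: q)
  have nz: "(of_nat ((r - 1) * l) :: 'a) \<noteq> 0" using assms(1,2) unfolding of_nat_eq_0_iff by simp
  have "q r = eval2 (Q l r) c \<delta>" using assms(2) by (simp add: q)
  also have "\<dots> = of_rat (1 / of_nat ((r - 1) * l)) *
      (P (l + 1) + \<delta> * P (2 * l + 1) - \<delta> * of_nat ((r - 1) * l + 1) * q (r - 1))"
    unfolding Q.simps[of l r] Ul_eq_U_sparse[OF assms(1,2)] Ul_check_eq_U_sparse[OF assms(1)]
      P_def n_def
    by (simp only: eval2_simps prod r if_False)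
  also have "of_rat (1 / of_nat ((r - 1) * l)) = (1 / of_nat ((r - 1) * l) :: 'a)"
    by (simp only: of_rat_divide of_rat_1 of_rat_of_nat_eq)
  finally have "q r = 1 / of_nat ((r - 1) * l) *
      (P (l + 1) + \<delta> * P (2 * l + 1) - \<delta> * of_nat ((r - 1) * l + 1) * q (r - 1))" .
  moreover have "b * a = R" if "b \<noteq> 0" "a = 1 / b * R" for a b R :: 'a
    using that by simp
  ultimately show ?thesis using nz by blast
qed

text \<open>The defect vanishes in degrees up to \<open>2l + 1\<close> by comparison with the solution \<open>x\<close>, where the
  factor \<open>l + 1 - m\<close> is zero for \<open>m = l + 1\<close>; in the degrees \<open>(r+1)l + 1\<close> with \<open>r \<ge> 2\<close> by the recursion; and
  in all others by the support condition.\<close>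
lemma Phi_tilde_in_AJ_sol_1:
  fixes c \<delta> :: "'a::field_char_0"
  assumes l: "1 \<le> l"
  shows "Phi_tilde l \<delta> c \<in> AJ_sol_1 (H_tilde l \<delta>)"
proof -
  define \<Phi> where "\<Phi> = Phi_tilde l \<delta> c"
  define q where "q = Phi_coeff l \<delta> c"
  have nth: "fps_nth \<Phi> (j * l + 1) = q j" for j
    using Phi_tilde_nth(1)[OF l] by (simp add: \<Phi>_def q_def)
  have nth0: "fps_nth \<Phi> n = 0" if "\<nexists>j. n = j * l + 1" for n
    using Phi_tilde_nth(2)[OF l that] by (simp add: \<Phi>_def)
  have \<Phi>01: "fps_nth \<Phi> 0 = 0" "fps_nth \<Phi> 1 = 1"
    using nth0[of 0] nth[of 0] by (auto simp: q_def Phi_coeff_0)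
  have "supported_mod l 1 \<Phi>"
    unfolding supported_mod_def
  proof (intro allI impI)
    fix n assume "fps_nth \<Phi> n \<noteq> 0"
    then obtain j where "n = j * l + 1" using nth0 by blast
    thus "[n = 1] (mod l)" using cong_1_iff[of n l] by auto
  qed
  hence supp: "supported_mod l 1 (AJ_defect l \<delta> \<Phi>)" by (rule supported_mod_AJ_defect)
  \<comment> \<open>\<open>\<Phi>\<close> and \<open>x\<close> agree below degree \<open>l + 1\<close>.\<close>
  have low: "fps_nth (AJ_defect l \<delta> \<Phi>) n = 0" if n: "n \<le> 2 * l + 1" for n
  proof -
    have "fps_nth \<Phi> j = fps_nth fps_X j" if "j < l + 1" for j
    proof (cases "j \<le> 1")
      case True
      thus ?thesis using \<Phi>01 by (cases j) auto
    next
      case False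
      have "\<nexists>k. j = k * l + 1"
      proof
        assume "\<exists>k. j = k * l + 1"
        then obtain k where k: "j = k * l + 1" ..
        hence "k * l < 1 * l" "k \<noteq> 0" using that False by (auto intro: Nat.gr0I)
        thus False by simp
      qed
      thus ?thesis using nth0 False by simp
    qed
    then obtain K where "AJ_defect l \<delta> \<Phi> - AJ_defect l \<delta> fps_X = fps_X ^ (l + 1 + l) * K" "fps_nth K 0 = 0"
      using AJ_defect_diff[of l "l + 1" \<Phi> fps_X \<delta>] l \<Phi>01 by auto
    moreover have "AJ_defect l \<delta> fps_X = 0" by (simp add: AJ_defect_def H_tilde_def)
    ultimately show ?thesis using n by (simp add: fps_X_power_mult_nth del: power_Suc)
  qed
  have high: "fps_nth (AJ_defect l \<delta> \<Phi>) ((r + 1) * l + 1) = 0" if r: "2 \<le> r" for r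
  proof -
    define n where "n = (r + 1) * l + 1"
    \<comment> \<open>Deleting the coefficient fixed in step \<open>r\<close> leaves a series whose defect in degree \<open>n\<close>
      involves only earlier coefficients.\<close>
    define g where "g = \<Phi> - fps_const (q r) * fps_X ^ (r * l + 1)"
    obtain s where s: "r = Suc (Suc s)" using r by (metis Suc_le_D numeral_2_eq_2 Suc_le_mono)
    have pos: "0 < r * l" using l s by simp
    have g01: "fps_nth g 0 = 0" "fps_nth g 1 = 1" using \<Phi>01 pos by (simp_all add: g_def)
    have gr: "fps_nth g (r * l + 1) = 0" using nth by (simp add: g_def)
    have gk: "fps_nth g (k * l + 1) = q k" if "k < r" for k
      using nth[of k] that l by (simp add: g_def)
    have "fps_nth \<Phi> j = fps_nth g j" if "j < r * l + 1" for j
      using that by (cases j) (auto simp: g_def)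
    then obtain K where K: "AJ_defect l \<delta> \<Phi> - AJ_defect l \<delta> g = fps_X ^ (r * l + 1 + l) * K"
      "fps_nth K 0 = (of_nat (l + 1) - of_nat (r * l + 1)) * (fps_nth \<Phi> (r * l + 1) - fps_nth g (r * l + 1))"
      using AJ_defect_diff[of l "r * l + 1" \<Phi> g \<delta>] l \<Phi>01 pos by auto
    have n: "n = r * l + 1 + l" "n - (l + 1) = r * l" "n - (2 * l + 1) = (r - 1) * l" "2 * l + 1 \<le> n" "l + 1 \<le> n"
      by (simp_all add: n_def s)
    have "fps_nth (AJ_defect l \<delta> \<Phi> - AJ_defect l \<delta> g) n = fps_nth K 0"
      unfolding K(1) n(1) fps_X_power_mult_nth by simp
    hence "fps_nth (AJ_defect l \<delta> \<Phi>) n = fps_nth (AJ_defect l \<delta> g) n + fps_nth K 0"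
      by (simp add: algebra_simps)
    also have "fps_nth K 0 = - (of_nat ((r - 1) * l) * q r)"
      unfolding K(2) gr nth by (simp add: s algebra_simps)
    also have "fps_nth (AJ_defect l \<delta> g) n = fps_nth (g ^ (l + 1)) n + \<delta> * fps_nth (g ^ (2 * l + 1)) n
        - \<delta> * of_nat ((r - 1) * l + 1) * q (r - 1)"
    proof -
      have "fps_nth (fps_deriv g * H_tilde l \<delta>) n =
          fps_nth (fps_deriv g) (n - (l + 1)) + \<delta> * fps_nth (fps_deriv g) (n - (2 * l + 1))"
        unfolding H_tilde_def distrib_left mult.left_commute[of _ "fps_const \<delta>"]
        using n(4,5) by (simp only: fps_add_nth fps_mult_left_const_nth fps_X_power_mult_right_nth) simp
      also have "\<dots> = \<delta> * (of_nat ((r - 1) * l + 1) * q (r - 1))"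
        using gr gk[of "r - 1"] r unfolding n(2,3) fps_deriv_nth by simp
      finally show ?thesis by (simp add: AJ_defect_def mult.assoc)
    qed
    also have "fps_nth (g ^ i) n = (\<Sum>u\<in>U_sparse l r n i. of_rat (B n i u) * (\<Prod>k=1..r - 1. q k ^ u (k * l + 1)))"
      if i: "l + 1 \<le> i" for i
    proof -
      have "fps_nth g j = 0" if j: "j + i \<le> n + 1" "\<nexists>k. k < r \<and> j = k * l + 1" for j
      proof (cases "j = r * l + 1")
        case False
        hence "j < r * l + 1" using j(1) i n(1) by linarith
        have "\<nexists>k. j = k * l + 1"
        proof
          assume "\<exists>k. j = k * l + 1"
          then obtain k where k: "j = k * l + 1" ..
          hence "k < r" using \<open>j < r * l + 1\<close> by simp
          thus False using j(2) k by blast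
        qed
        hence "fps_nth \<Phi> j = 0" by (rule nth0)
        thus ?thesis using False by (cases j) (auto simp: g_def)
      qed (use gr in simp)
      hence "fps_nth (g ^ i) n = (\<Sum>u\<in>U_sparse l r n i. of_rat (B n i u) *
          (\<Prod>k=1..r - 1. fps_nth g (k * l + 1) ^ u (k * l + 1)))"
        using g01 n(1) by (intro fps_power_nth_sparse[OF l]) auto
      also have "\<dots> = (\<Sum>u\<in>U_sparse l r n i. of_rat (B n i u) * (\<Prod>k=1..r - 1. q k ^ u (k * l + 1)))"
        using r by (intro sum.cong prod.cong arg_cong2[of _ _ _ _ "(*)"] arg_cong2[of _ _ _ _ "(^)"] gk refl) auto
      finally show ?thesis .
    qed
    note power_nth = this
    finally show ?thesis
      using Phi_coeff_recursion[OF l r, of \<delta> c] power_nth[of "l + 1"] power_nth[of "2 * l + 1"]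
      by (simp add: n_def q_def)
  qed
  have "AJ_defect l \<delta> \<Phi> = 0"
  proof (rule fps_ext)
    fix n
    show "fps_nth (AJ_defect l \<delta> \<Phi>) n = fps_nth 0 n"
    proof (cases "n \<le> 2 * l + 1")
      case False
      show ?thesis
      proof (rule ccontr)
        assume nz: "\<not> ?thesis"
        hence "[n = 1] (mod l)" using supp by (simp add: supported_mod_def)
        then obtain j where j: "n = j * l + 1" using False cong_1_iff[of n l] by auto
        hence "2 * l < j * l" using False by simp
        hence "2 < j" by simp
        then obtain r where "j = r + 1" "2 \<le> r" by (cases j) auto
        thus False using nz high[of r] j by simp
      qed
    qed (simp add: low)
  qed
  thus ?thesis using \<Phi>01 unfolding AJ_sol_1_iff \<Phi>_def by blast
qed

section \<open>The solution group\<close>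

text \<open>By existence and uniqueness the coefficient at \<open>x^(l+1)\<close> is a global parameter for the solutions.\<close>
lemma AJ_sol_1_eq_range:
  fixes \<delta> :: "'a::field_char_0"
  assumes "1 \<le> l"
  shows "AJ_sol_1 (H_tilde l \<delta>) = range (Phi_tilde l \<delta>)"
proof (intro equalityI subsetI)
  fix f assume f: "f \<in> AJ_sol_1 (H_tilde l \<delta>)"
  have "f = Phi_tilde l \<delta> (fps_nth f (l + 1))"
    using AJ_sol_1_unique[OF assms f Phi_tilde_in_AJ_sol_1[OF assms]]
      Phi_tilde_nth(1)[OF assms, of \<delta> _ 1] by (simp add: Phi_coeff_1)
  thus "f \<in> range (Phi_tilde l \<delta>)" by blast
qed (use Phi_tilde_in_AJ_sol_1[OF assms] in auto)

lemma Phi_tilde_nth_low: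
  fixes c \<delta> :: "'a::field_char_0"
  assumes "1 \<le> l" "n \<le> l + 1"
  shows "fps_nth (Phi_tilde l \<delta> c) n = (if n = 1 then 1 else if n = l + 1 then c else 0)"
proof -
  consider "n = 0 * l + 1" | "n = 1 * l + 1" | "n \<noteq> 1" "n \<noteq> l + 1" by fastforce
  thus ?thesis
  proof cases
    case 3
    have "\<nexists>j. n = j * l + 1"
    proof
      assume "\<exists>j. n = j * l + 1"
      then obtain j where j: "n = j * l + 1" ..
      hence "j * l < 1 * l" "j \<noteq> 0" using assms(2) 3 by auto
      thus False by simp
    qed
    thus ?thesis using 3 Phi_tilde_nth(2)[OF assms(1)] by simp
  next
    case 1
    thus ?thesis using Phi_tilde_nth(1)[OF assms(1), of \<delta> c 0] by (simp add: Phi_coeff_0)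
  next
    case 2
    thus ?thesis using Phi_tilde_nth(1)[OF assms(1), of \<delta> c 1] assms(1) by (simp add: Phi_coeff_1)
  qed
qed

text \<open>By the chain rule,
  \<open>H \<circ> f \<circ> g = (f' H) \<circ> g = (f' \<circ> g) (H \<circ> g) = (f' \<circ> g) g' H = (f \<circ> g)' H\<close>.\<close>
lemma AJ_sol_1_compose:
  fixes H :: "'a::field_char_0 fps"
  assumes "f \<in> AJ_sol_1 H" "g \<in> AJ_sol_1 H"
  shows "f oo g \<in> AJ_sol_1 H"
proof -
  have f: "fps_nth f 0 = 0" "fps_nth f 1 = 1" "H oo f = fps_deriv f * H"
    and g: "fps_nth g 0 = 0" "fps_nth g 1 = 1" "H oo g = fps_deriv g * H"
    using assms by (auto simp: AJ_sol_1_def AJ_sol_def Gamma_inf_1_def Gamma_inf_def)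
  have "H oo (f oo g) = (fps_deriv f oo g) * (fps_deriv g * H)"
    using f g by (simp add: fps_compose_assoc fps_compose_mult_distrib)
  also have "\<dots> = fps_deriv (f oo g) * H"
    using g by (simp add: fps_compose_deriv mult.assoc)
  finally have "H oo (f oo g) = fps_deriv (f oo g) * H" .
  moreover have "fps_nth (f oo g) 1 = 1"
    using f g by (simp add: fps_compose_nth)
  ultimately show ?thesis
    using f by (simp add: AJ_sol_1_def AJ_sol_def Gamma_inf_1_def Gamma_inf_def)
qed

text \<open>Both sides are solutions, so it suffices to compare the coefficients at \<open>x^(l+1)\<close>.\<close>
lemma Phi_tilde_compose:
  fixes c d \<delta> :: "'a::field_char_0"
  assumes l: "1 \<le> l"
  shows "Phi_tilde l \<delta> c oo Phi_tilde l \<delta> d = Phi_tilde l \<delta> (c + d)"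
proof (rule AJ_sol_1_unique[OF l])
  let ?f = "Phi_tilde l \<delta> c" and ?g = "Phi_tilde l \<delta> d"
  show "?f oo ?g \<in> AJ_sol_1 (H_tilde l \<delta>)" "Phi_tilde l \<delta> (c + d) \<in> AJ_sol_1 (H_tilde l \<delta>)"
    using AJ_sol_1_compose Phi_tilde_in_AJ_sol_1[OF l] by blast+
  \<comment> \<open>Below degree \<open>l + 2\<close> the outer series consists of \<open>x + c x^(l+1)\<close> only.\<close>
  have "fps_nth (?f oo ?g) (l + 1) = (\<Sum>i\<in>{1, l + 1}. fps_nth ?f i * fps_nth (?g ^ i) (l + 1))"
    unfolding fps_compose_nth using l
    by (intro sum.mono_neutral_right) (auto simp: Phi_tilde_nth_low)
  also have "\<dots> = fps_nth ?g (l + 1) + c * fps_nth (?g ^ (l + 1)) (l + 1)"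
    using l Phi_tilde_nth_low[OF l, of 1 \<delta> c] Phi_tilde_nth_low[OF l, of "l + 1" \<delta> c]
    by (simp del: power_Suc)
  also have "fps_nth (?g ^ (l + 1)) (l + 1) = 1"
    by (subst startsby_zero_power_nth_same) (use l in \<open>simp_all add: Phi_tilde_nth_low\<close>)
  finally show "fps_nth (?f oo ?g) (l + 1) = fps_nth (Phi_tilde l \<delta> (c + d)) (l + 1)"
    using l by (simp add: Phi_tilde_nth_low)
qed

lemma Phi_tilde_0:
  assumes "1 \<le> l"
  shows "Phi_tilde l \<delta> (0 :: 'a::field_char_0) = fps_X"
proof (rule AJ_sol_1_unique[OF assms])
  show "fps_X \<in> AJ_sol_1 (H_tilde l \<delta>)"
    unfolding AJ_sol_1_iff by (simp add: AJ_defect_def H_tilde_def)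
qed (use assms in \<open>simp_all add: Phi_tilde_in_AJ_sol_1 Phi_tilde_nth_low\<close>)

lemma comm_group_additive: "comm_group (additive_group :: 'a::field_char_0 monoid)"
proof (rule comm_groupI)
  fix x :: 'a
  show "\<exists>y\<in>carrier additive_group. y \<otimes>\<^bsub>additive_group\<^esub> x = \<one>\<^bsub>additive_group\<^esub>"
    by (rule bexI[of _ "- x"]) (simp_all add: additive_group_def)
qed (simp_all add: additive_group_def algebra_simps)

lemma Phi_tilde_iso:
  fixes \<delta> :: "'a::field_char_0"
  assumes l: "1 \<le> l"
  shows "Phi_tilde l \<delta> \<in> iso additive_group (AJ_group_1 (H_tilde l \<delta>))"
proof (rule isoI)
  show "Phi_tilde l \<delta> \<in> hom additive_group (AJ_group_1 (H_tilde l \<delta>))"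
    using Phi_tilde_compose[OF l, symmetric] Phi_tilde_in_AJ_sol_1[OF l]
    by (auto simp: hom_def additive_group_def AJ_group_1_def Gamma_inf_def)
  have "inj (Phi_tilde l \<delta>)"
  proof (rule injI)
    fix c d assume "Phi_tilde l \<delta> c = Phi_tilde l \<delta> d"
    hence "fps_nth (Phi_tilde l \<delta> c) (l + 1) = fps_nth (Phi_tilde l \<delta> d) (l + 1)" by simp
    thus "c = d" using l by (simp add: Phi_tilde_nth_low)
  qed
  thus "bij_betw (Phi_tilde l \<delta>) (carrier additive_group) (carrier (AJ_group_1 (H_tilde l \<delta>)))"
    by (simp add: bij_betw_def additive_group_def AJ_group_1_def AJ_sol_1_eq_range[OF l])
qed

text \<open>With \<open>q = x + d x^(l+1)\<close>, the only nonlinear contribution is \<open>c q^(l+1)\<close>, which is \<open>c x^(l+1)\<close> modulo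
  \<open>x^(l+2)\<close>.\<close>
lemma Gamma_ll_1_mult:
  fixes c d :: "'a::field_char_0"
  assumes l: "1 \<le> l"
  shows "([:0, 1:] + monom c (l + 1)) \<otimes>\<^bsub>Gamma_ll_1 l\<^esub> ([:0, 1:] + monom d (l + 1)) =
    [:0, 1:] + monom (c + d) (l + 1)"
proof -
  have pcompose_monom: "pcompose (monom c k) p = smult c (p ^ k)" for k and p :: "'a poly"
    by (induction k) (simp_all add: monom_0 monom_Suc pcompose_pCons)
  let ?X = "monom 1 1 :: 'a poly" and ?q = "[:0, 1:] + monom d (l + 1)"
  obtain l' where l': "l = Suc l'" using l by (cases l) auto
  have X: "[:0, 1:] = ?X" by (simp add: monom_altdef)
  \<comment> \<open>The inner series is \<open>x w\<close>; since \<open>w\<close> has constant term \<open>1\<close>, so has \<open>w^(l+1) = 1 + x v\<close>.\<close>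
  define w where "w = 1 + monom d l"
  have q: "?q = ?X * w" by (simp add: w_def X mult_monom distrib_left)
  have "coeff (w ^ (l + 1)) 0 = 1"
    by (simp add: w_def l' coeff_0_power poly_monom flip: poly_0_coeff_0)
  moreover obtain a v where av: "w ^ (l + 1) = pCons a v" by (rule pCons_cases)
  ultimately have v: "w ^ (l + 1) = 1 + ?X * v"
    unfolding X[symmetric] av by (simp add: one_pCons)
  have X_pow: "?X ^ k = monom 1 k" for k by (simp add: monom_power)
  have "pcompose ([:0, 1:] + monom c (l + 1)) ?q = ?q + smult c (?q ^ (l + 1))"
    by (simp only: pcompose_add pcompose_monom) (simp add: pcompose_pCons)
  also have "?q ^ (l + 1) = monom 1 (l + 1) * (1 + ?X * v)"
    unfolding q power_mult_distrib v X_pow ..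
  also have "\<dots> = monom 1 (l + 1) + (monom 1 (l + 1) * ?X) * v"
    by (simp only: distrib_left mult_1_right mult.assoc)
  also have "monom 1 (l + 1) * ?X = monom 1 (l + 1 + 1)"
    by (simp add: mult_monom)
  also have "?q + smult c (monom 1 (l + 1) + \<dots> * v) = ([:0, 1:] + monom (c + d) (l + 1)) + smult c v * monom 1 (l + 1 + 1)"
    by (simp only: smult_add_right smult_monom mult_1_left mult_1_right mult_smult_left add_monom[symmetric] add_ac mult_ac)
  finally have "pcompose ([:0, 1:] + monom c (l + 1)) ?q mod monom 1 (l + 1 + 1) =
      ([:0, 1:] + monom (c + d) (l + 1)) mod monom 1 (l + 1 + 1)" by (simp only: mod_mult_self1)
  also have "\<dots> = [:0, 1:] + monom (c + d) (l + 1)"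
  proof (rule mod_poly_less)
    have "degree ([:0, 1:] + monom (c + d) (l + 1)) \<le> l + 1"
      by (intro degree_add_le) (simp_all add: degree_monom_le)
    thus "degree ([:0, 1:] + monom (c + d) (l + 1)) < degree (monom (1 :: 'a) (l + 1 + 1))"
      by (simp add: degree_monom_eq)
  qed
  finally show ?thesis by (simp add: Gamma_ll_1_def Gamma_trunc_def)
qed

text \<open>The group axioms hold because the structure is the isomorphic image of a commutative group, with
  the series \<open>x\<close> as the image of \<open>0\<close>.\<close>
lemma comm_group_AJ_group_1:
  fixes \<delta> :: "'a::field_char_0"
  assumes l: "1 \<le> l"
  shows "comm_group (AJ_group_1 (H_tilde l \<delta>))"
proof -
  have "AJ_group_1 (H_tilde l \<delta>)\<lparr>one := Phi_tilde l \<delta> \<one>\<^bsub>additive_group\<^esub>\<rparr> = AJ_group_1 (H_tilde l \<delta>)"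
    by (simp add: AJ_group_1_def Gamma_inf_def additive_group_def Phi_tilde_0[OF l])
  thus ?thesis
    using comm_group.iso_imp_img_comm_group[OF comm_group_additive Phi_tilde_iso[OF l]] by metis
qed

lemma truncation_iso:
  fixes \<delta> :: "'a::field_char_0"
  assumes l: "1 \<le> l"
  shows "truncation (l + 1) \<in> iso (AJ_group_1 (H_tilde l \<delta>)) (Gamma_ll_1 l)"
proof -
  have trunc: "truncation (l + 1) (Phi_tilde l \<delta> c) = [:0, 1:] + monom c (l + 1)" for c
  proof -
    have "truncation (l + 1) (Phi_tilde l \<delta> c) =
        (\<Sum>j\<in>{1, l + 1}. monom (fps_nth (Phi_tilde l \<delta> c) j) j)"
      unfolding truncation_def using l
      by (intro sum.mono_neutral_right) (auto simp: Phi_tilde_nth_low)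
    also have "\<dots> = monom 1 1 + monom c (l + 1)"
      using l Phi_tilde_nth_low[OF l, of 1 \<delta> c] Phi_tilde_nth_low[OF l, of "l + 1" \<delta> c] by simp
    finally show ?thesis by (simp add: monom_altdef)
  qed
  have carrier: "carrier (AJ_group_1 (H_tilde l \<delta>)) = range (Phi_tilde l \<delta>)"
    by (simp add: AJ_group_1_def AJ_sol_1_eq_range[OF l])
  have mult: "f \<otimes>\<^bsub>AJ_group_1 (H_tilde l \<delta>)\<^esub> g = f oo g" for f g
    by (simp add: AJ_group_1_def Gamma_inf_def)
  have carrier': "carrier (Gamma_ll_1 l) = range (\<lambda>c :: 'a. [:0, 1:] + monom c (l + 1))"
    by (auto simp: Gamma_ll_1_def)
  show ?thesis
  proof (rule isoI)
    show "truncation (l + 1) \<in> hom (AJ_group_1 (H_tilde l \<delta>)) (Gamma_ll_1 l)"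
    proof (rule homI)
      fix f g assume "f \<in> carrier (AJ_group_1 (H_tilde l \<delta>))" "g \<in> carrier (AJ_group_1 (H_tilde l \<delta>))"
      then obtain c d where "f = Phi_tilde l \<delta> c" "g = Phi_tilde l \<delta> d" unfolding carrier by blast
      thus "truncation (l + 1) (f \<otimes>\<^bsub>AJ_group_1 (H_tilde l \<delta>)\<^esub> g) =
          truncation (l + 1) f \<otimes>\<^bsub>Gamma_ll_1 l\<^esub> truncation (l + 1) g"
        by (simp only: mult Phi_tilde_compose[OF l] trunc Gamma_ll_1_mult[OF l])
    qed (auto simp: carrier carrier' trunc simp del: One_nat_def)
    have "inj_on (truncation (l + 1)) (range (Phi_tilde l \<delta>))"
      by (rule inj_onI) (auto simp: trunc simp del: One_nat_def)
    thus "bij_betw (truncation (l + 1)) (carrier (AJ_group_1 (H_tilde l \<delta>))) (carrier (Gamma_ll_1 l))"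
      by (simp add: bij_betw_def carrier carrier' image_image trunc del: One_nat_def)
  qed
qed

lemma group_Gamma_ll_1:
  assumes l: "1 \<le> l"
  shows "group (Gamma_ll_1 l :: 'a::field_char_0 poly monoid)"
proof -
  have hom: "(\<lambda>c. [:0, 1:] + monom c (l + 1)) \<in> hom additive_group (Gamma_ll_1 l :: 'a poly monoid)"
  proof (rule homI)
    show "[:0, 1:] + monom c (l + 1) \<in> carrier (Gamma_ll_1 l)" for c :: 'a
      by (auto simp: Gamma_ll_1_def)
  qed (simp only: Gamma_ll_1_mult[OF l], simp add: additive_group_def)
  have "(Gamma_ll_1 l)\<lparr>carrier := (\<lambda>c :: 'a. [:0, 1:] + monom c (l + 1)) ` carrier additive_group,
      one := [:0, 1:] + monom (\<one>\<^bsub>additive_group\<^esub>) (l + 1)\<rparr> = Gamma_ll_1 l"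
    by (auto simp: Gamma_ll_1_def Gamma_trunc_def additive_group_def)
  thus ?thesis
    using group.hom_imp_img_group[OF comm_group.axioms(2)[OF comm_group_additive] hom] by metis
qed

theorem theorem4:
  fixes l :: nat and \<delta> :: "'a::field_char_0"
  assumes "l \<ge> 1"
  shows "(\<forall>c. Phi_tilde l \<delta> c \<in> AJ_sol_1 (H_tilde l \<delta>) \<and>
              fps_nth (Phi_tilde l \<delta> c) (l + 1) = c \<and>
              (\<forall>\<Psi> \<in> AJ_sol_1 (H_tilde l \<delta>). fps_nth \<Psi> (l + 1) = c \<longrightarrow> \<Psi> = Phi_tilde l \<delta> c))
         \<and> AJ_sol_1 (H_tilde l \<delta>) \<subseteq> N_inf l
         \<and> group (Gamma_ll_1 l :: 'a poly monoid)
         \<and> truncation (l + 1) \<in> iso (AJ_group_1 (H_tilde l \<delta>)) (Gamma_ll_1 l)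
         \<and> comm_group (AJ_group_1 (H_tilde l \<delta>))
         \<and> AJ_group_1 (H_tilde l \<delta>) \<cong> (additive_group :: 'a monoid)"
proof (intro conjI allI ballI impI)
  fix c :: 'a
  show in_sol: "Phi_tilde l \<delta> c \<in> AJ_sol_1 (H_tilde l \<delta>)"
    by (rule Phi_tilde_in_AJ_sol_1) fact
  show nth: "fps_nth (Phi_tilde l \<delta> c) (l + 1) = c"
    using assms by (simp add: Phi_tilde_nth_low)
  fix \<Psi> assume "\<Psi> \<in> AJ_sol_1 (H_tilde l \<delta>)" "fps_nth \<Psi> (l + 1) = c"
  thus "\<Psi> = Phi_tilde l \<delta> c"
    using AJ_sol_1_unique[OF assms _ in_sol] nth by simp
next
  have "Phi_tilde l \<delta> c \<in> carrier Gamma_inf" for c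
    using Phi_tilde_in_AJ_sol_1[OF assms] by (auto simp: AJ_sol_1_def AJ_sol_def)
  moreover have "\<exists>j. m = j * l + 1" if "fps_nth (Phi_tilde l \<delta> c) m \<noteq> 0" for c m
    using Phi_tilde_nth(2)[OF assms] that by blast
  ultimately show "AJ_sol_1 (H_tilde l \<delta>) \<subseteq> N_inf l"
    unfolding AJ_sol_1_eq_range[OF assms] N_inf_def by blast
next
  show "AJ_group_1 (H_tilde l \<delta>) \<cong> (additive_group :: 'a monoid)"
    using group.iso_sym[OF comm_group.axioms(2)[OF comm_group_additive]] Phi_tilde_iso[OF assms]
    unfolding is_iso_def by blast
qed (use assms in \<open>simp_all only: group_Gamma_ll_1 truncation_iso comm_group_AJ_group_1\<close>)

end
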